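(* Let $P=(P_i)_{i=1}^m$ be measurable functions $P_i:\mathbb{R}\to[0,\infty)$ with $\sum_{i=1}^m P_i(z)=1$ for all $z\in\mathbb{R}$. Then $\hat Y_P(Z)$ is independent of $X$ (perfect privacy) if and only if $$\int_{\mathbb{R}} P_i(z)\big(p_Z(z)-p_Z(z\mid X=x_j)\big)\,dz=0\qquad\text{for all } i\in\{1,\dots,m\},\ j\in\{1,\dots,n\}.$$ Consequently, the optimal perfect privacy estimator (the minimizer of $\mathsf{E}[L(Y,\hat Y_P(Z))]$ over all such $P$ for which $\hat Y_P(Z)$ is independent of $X$) is the solution of an infinite-dimensional linear optimization problem: minimize $\mathsf{E}[L(Y,\hat Y_P(Z))]$, which is linear in $P$ up to an additive constant, subject to the linear constraints $P_i(z)\ge0$ for all $i,z$, $\sum_iP_i(z)=1$ for all $z$, and the integral equalities displayed above.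
   Context: $X$ (private) and $Y$ (public) are possibly correlated discrete random variables with finite support sets $\mathcal{X}=\{x_1,\dots,x_n\}$ and $\mathcal{Y}=\{y_1,\dots,y_m\}$ (so $\Pr(X=x_j)>0$ for all $j$). The measurement $Z$ is a real random variable, jointly distributed with $(X,Y)$, absolutely continuous with respect to Lebesgue measure with density $p_Z$; $p_Z(\cdot\mid X=x_j)$ is the conditional density of $Z$ given $X=x_j$. Randomized estimator: $\hat Y_P(Z)$ is the $\mathcal{Y}$-valued random variable that, given $Z=z$, equals $y_i$ with probability $P_i(z)$, the randomization being conditionally independent of $(X,Y)$ given $Z$. Loss: $L(Y,\hat Y)=1$ if $Y\neq\hat Y$, and $0$ otherwise. *)

theory Defs
  imports "HOL-Probability.Probability"
begin

text \<open>The library's \<open>indep_var\<close> forces both random variables to have the same value type; here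
  they may have different ones, so independence is stated for the generated sigma-algebras.\<close>

definition indep_rv ::
  "'w measure \<Rightarrow> 'a measure \<Rightarrow> ('w \<Rightarrow> 'a) \<Rightarrow> 'b measure \<Rightarrow> ('w \<Rightarrow> 'b) \<Rightarrow> bool" where
  "indep_rv M S A T B \<longleftrightarrow>
     A \<in> measurable M S \<and> B \<in> measurable M T \<and>
     prob_space.indep_set M (sets (vimage_algebra (space M) A S)) (sets (vimage_algebra (space M) B T))"

text \<open>(A version of) the conditional probability of the event \<open>E\<close> given the sigma-algebra
  generated by \<open>Z\<close>.\<close>

definition cond_prob_given :: "'w measure \<Rightarrow> ('w \<Rightarrow> real) \<Rightarrow> ('w \<Rightarrow> bool) \<Rightarrow> 'w \<Rightarrow> real" where
  "cond_prob_given M Z E =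
     real_cond_exp M (vimage_algebra (space M) Z borel) (indicator {\<omega> \<in> space M. E \<omega>})"

text \<open>Tuples \<open>(P\<^sub>1, \<dots>, P\<^sub>m)\<close> of functions are represented by \<open>P :: nat \<Rightarrow> real \<Rightarrow> real\<close>, of which only
  the components with index in \<open>{1..m}\<close> matter.\<close>

definition randomization_rule :: "nat \<Rightarrow> (nat \<Rightarrow> real \<Rightarrow> real) \<Rightarrow> bool" where
  "randomization_rule m P \<longleftrightarrow>
     (\<forall>i\<in>{1..m}. P i \<in> borel_measurable borel) \<and>
     (\<forall>i\<in>{1..m}. \<forall>z. 0 \<le> P i z) \<and>
     (\<forall>z. (\<Sum>i\<in>{1..m}. P i z) = 1)"

text \<open>\<open>W\<close> is a version of the estimator randomized according to \<open>P\<close>: given \<open>Z = z\<close> it equals \<open>y i\<close>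
  with probability \<open>P i z\<close>, and it is conditionally independent of \<open>(X, Y)\<close> given \<open>Z\<close>.\<close>

definition randomized_estimator ::
  "'w measure \<Rightarrow> ('w \<Rightarrow> 'a) \<Rightarrow> ('w \<Rightarrow> 'b) \<Rightarrow> ('w \<Rightarrow> real) \<Rightarrow> nat \<Rightarrow> (nat \<Rightarrow> 'b) \<Rightarrow>
     (nat \<Rightarrow> real \<Rightarrow> real) \<Rightarrow> ('w \<Rightarrow> 'b) \<Rightarrow> bool" where
  "randomized_estimator M X Y Z m y P W \<longleftrightarrow>
     W \<in> measurable M (count_space (y ` {1..m})) \<and>
     (\<forall>i\<in>{1..m}. AE \<omega> in M. cond_prob_given M Z (\<lambda>\<omega>. W \<omega> = y i) \<omega> = P i (Z \<omega>)) \<and>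
     (\<forall>S T. AE \<omega> in M.
        cond_prob_given M Z (\<lambda>\<omega>. W \<omega> \<in> S \<and> (X \<omega>, Y \<omega>) \<in> T) \<omega> =
        cond_prob_given M Z (\<lambda>\<omega>. W \<omega> \<in> S) \<omega> * cond_prob_given M Z (\<lambda>\<omega>. (X \<omega>, Y \<omega>) \<in> T) \<omega>)"

definition zero_one_loss :: "'b \<Rightarrow> 'b \<Rightarrow> real" where
  "zero_one_loss y y' = (if y \<noteq> y' then 1 else 0)"

definition expected_loss :: "'w measure \<Rightarrow> ('w \<Rightarrow> 'b) \<Rightarrow> ('w \<Rightarrow> 'b) \<Rightarrow> real" where
  "expected_loss M Y W = prob_space.expectation M (\<lambda>\<omega>. zero_one_loss (Y \<omega>) (W \<omega>))"

text \<open>The vector space in which the optimization takes place. Boundedness, which every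
  randomization rule satisfies, makes all integrals against densities exist.\<close>

definition decision_space :: "nat \<Rightarrow> (nat \<Rightarrow> real \<Rightarrow> real) set" where
  "decision_space m = {P. \<forall>i\<in>{1..m}. P i \<in> borel_measurable borel \<and> bounded (range (P i))}"

definition linear_functional :: "nat \<Rightarrow> ((nat \<Rightarrow> real \<Rightarrow> real) \<Rightarrow> real) \<Rightarrow> bool" where
  "linear_functional m \<phi> \<longleftrightarrow>
     (\<forall>P\<in>decision_space m. \<forall>Q\<in>decision_space m. \<forall>a b.
        \<phi> (\<lambda>i z. a * P i z + b * Q i z) = a * \<phi> P + b * \<phi> Q)"

text \<open>There are arbitrarily large finite linearly independent families of tuples.\<close>

definition infinite_dimensional :: "nat \<Rightarrow> (nat \<Rightarrow> real \<Rightarrow> real) set \<Rightarrow> bool" where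
  "infinite_dimensional m V \<longleftrightarrow>
     (\<forall>k. \<exists>B. (\<forall>r<k. B r \<in> V) \<and>
        (\<forall>c :: nat \<Rightarrow> real. (\<forall>i\<in>{1..m}. \<forall>z. (\<Sum>r<k. c r * B r i z) = 0) \<longrightarrow> (\<forall>r<k. c r = 0)))"

end

theory Submission
  imports Defs
begin

text \<open>
  By conditional independence and the pull-out property of conditional expectation,
  \<open>Pr(W = y i, (X, Y) \<in> T) = E[P i (Z) 1{(X, Y) \<in> T}]\<close> for every set \<open>T\<close>. Taking all pairs for \<open>T\<close>
  gives \<open>Pr(W = y i) = \<integral> P i p\<^sub>Z\<close>, and fixing \<open>X = x j\<close> gives
  \<open>Pr(W = y i, X = x j) = Pr(X = x j) \<integral> P i p\<^sub>Z(\<cdot> | X = x j)\<close>, so the integral equalities say exactly that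
  the joint probabilities of \<open>W\<close> and \<open>X\<close> factor. Fixing \<open>Y = y i\<close> and summing over \<open>i\<close> gives
  \<open>E[L(Y, W)] = 1 - (\<Sum>i. E[P i (Z) 1{Y = y i}])\<close>, which is affine in \<open>P\<close>.
\<close>

section \<open>Events described by discrete random variables\<close>

lemma measurable_count_space_pred:
  assumes "X \<in> measurable M (count_space A)"
  shows "{\<omega> \<in> space M. Q (X \<omega>)} \<in> sets M"
proof -
  have "{\<omega> \<in> space M. Q (X \<omega>)} = X -` {a \<in> A. Q a} \<inter> space M"
    using measurable_space[OF assms] by auto
  then show ?thesis
    using measurable_sets[OF assms, of "{a \<in> A. Q a}"] by simp
qed

text \<open>Splitting along the finitely many values of \<open>X\<close> turns the event into a
  finite union of intersections of one-variable events, so \<open>T\<close> may be an arbitrary set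
  of pairs.\<close>

lemma measurable_Pair_pred_sets:
  assumes "finite A" "X \<in> measurable M (count_space A)" "Y \<in> measurable M (count_space B)"
  shows "{\<omega> \<in> space M. (X \<omega>, Y \<omega>) \<in> T} \<in> sets M"
proof -
  have "{\<omega> \<in> space M. (X \<omega>, Y \<omega>) \<in> T} =
      (\<Union>a\<in>A. {\<omega> \<in> space M. X \<omega> = a} \<inter> {\<omega> \<in> space M. (a, Y \<omega>) \<in> T})"
    using measurable_space[OF assms(2)] by auto
  also have "\<dots> \<in> sets M"
    using assms(1) measurable_count_space_pred[OF assms(2), of "\<lambda>b. b = _"]
      measurable_count_space_pred[OF assms(3), of "\<lambda>b. (_, b) \<in> T"]
    by (intro sets.finite_UN sets.Int) auto
  finally show ?thesis .
qed

section \<open>Boundedness of rules and integrability of densities\<close>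

lemma randomization_rule_le_one:
  assumes "randomization_rule m P" "i \<in> {1..m}"
  shows "P i z \<le> 1"
proof -
  have "P i z \<le> (\<Sum>i\<in>{1..m}. P i z)"
    using assms by (intro member_le_sum) (auto simp: randomization_rule_def)
  then show ?thesis
    using assms by (simp add: randomization_rule_def)
qed

lemma randomization_rule_decision_space:
  assumes "randomization_rule m P"
  shows "P \<in> decision_space m"
proof -
  have "bounded (range (P i))" if "i \<in> {1..m}" for i
    using assms that randomization_rule_le_one[OF assms that]
    by (intro boundedI[where B = 1]) (auto simp: randomization_rule_def)
  then show ?thesis
    using assms by (simp add: decision_space_def randomization_rule_def)
qed

lemma integrable_bounded_mult:
  fixes f g :: "'c \<Rightarrow> real"
  assumes "integrable M g" "f \<in> borel_measurable M" "bounded (range f)"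
  shows "integrable M (\<lambda>x. f x * g x)"
proof -
  obtain C where C: "\<And>x. \<bar>f x\<bar> \<le> C"
    using assms(3) by (auto simp: bounded_iff)
  have "norm (f x * g x) \<le> norm (C * g x)" for x
    using mult_right_mono[OF order.trans[OF C[of x] abs_ge_self], of "\<bar>g x\<bar>"] by (simp add: abs_mult)
  then show ?thesis
    using assms(1,2)
    by (intro Bochner_Integration.integrable_bound[OF integrable_mult_right[OF assms(1), of C]]) auto
qed

text \<open>The constant 1 is integrable over a probability space; transferring this along
  \<open>Z\<close> gives integrability of the density.\<close>

lemma distributed_integrable_density:
  assumes "prob_space M" "distributed M lborel Z (\<lambda>z. ennreal (p z))" "\<And>z. 0 \<le> p z"
  shows "integrable lborel p"
proof -
  interpret prob_space M by fact
  show ?thesis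
    using distributed_integrable[OF assms(2), of "\<lambda>_. 1"] assms(3) by simp
qed

section \<open>Joint probabilities as integrals of the rule\<close>

lemma prob_estimator_joint:
  fixes Z :: "'w \<Rightarrow> real"
  assumes "prob_space M"
    and Z: "Z \<in> borel_measurable M"
    and rule: "randomization_rule m P"
    and est: "randomized_estimator M X Y Z m y P W"
    and i: "i \<in> {1..m}"
    and T: "{\<omega> \<in> space M. (X \<omega>, Y \<omega>) \<in> T} \<in> sets M"
  shows "measure M {\<omega> \<in> space M. W \<omega> = y i \<and> (X \<omega>, Y \<omega>) \<in> T} =
    (LINT \<omega>|M. P i (Z \<omega>) * indicator {\<omega> \<in> space M. (X \<omega>, Y \<omega>) \<in> T} \<omega>)"
proof -
  interpret prob_space M by fact
  define F where "F = vimage_algebra (space M) Z borel"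
  \<comment> \<open>Measurability of \<open>Z\<close> places its generated sigma-algebra inside that
    of \<open>M\<close>; finiteness of \<open>M\<close> then makes conditional expectations given
    \<open>F\<close> well behaved.\<close>
  have "subalgebra M F"
    unfolding subalgebra_def F_def using Z by (auto simp: sets_vimage_algebra2 intro: measurable_sets)
  then interpret F: finite_measure_subalgebra M F
    by unfold_locales
  let ?E = "{\<omega> \<in> space M. (X \<omega>, Y \<omega>) \<in> T}"
  let ?V = "{\<omega> \<in> space M. W \<omega> = y i \<and> (X \<omega>, Y \<omega>) \<in> T}"
  have W: "W \<in> measurable M (count_space (y ` {1..m}))"
    using est by (simp add: randomized_estimator_def)
  have V: "?V \<in> sets M"
    using sets.Int[OF T measurable_count_space_pred[OF W, of "\<lambda>w. w = y i"]]
    by (rule back_subst[where P = "\<lambda>A. A \<in> sets M"]) auto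
  have P: "P i \<in> borel_measurable borel" "\<And>z. 0 \<le> P i z" "\<And>z. P i z \<le> 1"
    using rule i randomization_rule_le_one[OF rule i] by (auto simp: randomization_rule_def)
  have Zf: "Z \<in> borel_measurable F"
    unfolding F_def by (rule measurable_vimage_algebra1) simp
  have PZ: "(\<lambda>\<omega>. P i (Z \<omega>)) \<in> borel_measurable F"
    using measurable_compose[OF Zf P(1)] .
  have PZM: "(\<lambda>\<omega>. P i (Z \<omega>)) \<in> borel_measurable M"
    using measurable_compose[OF Z P(1)] .
  have "measure M ?V = (LINT \<omega>|M. indicator ?V \<omega>)"
    using V by simp
  \<comment> \<open>Conditional expectation preserves the integral.\<close>
  also have "\<dots> = (LINT \<omega>|M. real_cond_exp M F (indicator ?V) \<omega>)"
    using V by (intro F.real_cond_exp_int(2)[symmetric]) (simp add: integrable_indicator_iff less_top[symmetric])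
  also have "\<dots> = (LINT \<omega>|M. P i (Z \<omega>) * real_cond_exp M F (indicator ?E) \<omega>)"
  proof (rule integral_cong_AE)
    \<comment> \<open>Conditional independence is used with the singleton \<open>{y i}\<close>, so
      that its first factor can be replaced by \<open>P i (Z \<omega>)\<close>.\<close>
    have "AE \<omega> in M. cond_prob_given M Z (\<lambda>\<omega>. W \<omega> \<in> {y i} \<and> (X \<omega>, Y \<omega>) \<in> T) \<omega> =
        cond_prob_given M Z (\<lambda>\<omega>. W \<omega> \<in> {y i}) \<omega> * cond_prob_given M Z (\<lambda>\<omega>. (X \<omega>, Y \<omega>) \<in> T) \<omega>"
      using est unfolding randomized_estimator_def by blast
    moreover have "AE \<omega> in M. cond_prob_given M Z (\<lambda>\<omega>. W \<omega> = y i) \<omega> = P i (Z \<omega>)"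
      using est i unfolding randomized_estimator_def by blast
    ultimately show "AE \<omega> in M. real_cond_exp M F (indicator ?V) \<omega> =
        P i (Z \<omega>) * real_cond_exp M F (indicator ?E) \<omega>"
      by eventually_elim (simp add: cond_prob_given_def F_def)
  qed (use PZM in simp_all)
  \<comment> \<open>Pull-out: \<open>P i (Z \<omega>)\<close> is \<open>F\<close>-measurable, so
    under the integral the conditional expectation of the other factor may be removed.\<close>
  also have "\<dots> = (LINT \<omega>|M. P i (Z \<omega>) * indicator ?E \<omega>)"
  proof (rule F.real_cond_exp_intg(2))
    show "integrable M (\<lambda>\<omega>. P i (Z \<omega>) * indicator ?E \<omega>)"
      using PZM T P(2,3) by (intro integrable_const_bound[where B = 1]) (auto simp: indicator_def)
  qed (use PZ T in simp_all)
  finally show ?thesis .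
qed

text \<open>Conditioning on \<open>A\<close> means having density
  \<open>indicator A / measure M A\<close> with respect to \<open>M\<close>. An expectation under
  the conditional law of \<open>Z\<close> is therefore an integral over \<open>A\<close>, divided by
  the probability of \<open>A\<close>.\<close>

lemma integral_uniform_measure_distributed:
  fixes Z :: "'w \<Rightarrow> real" and g :: "real \<Rightarrow> real"
  assumes "prob_space M" "A \<in> sets M" "measure M A > 0"
    and p: "distributed (uniform_measure M A) lborel Z (\<lambda>z. ennreal (p z))" "\<And>z. 0 \<le> p z"
    and g: "g \<in> borel_measurable borel"
  shows "(LINT \<omega>|M. g (Z \<omega>) * indicator A \<omega>) = measure M A * (LINT z|lborel. g z * p z)"
proof -
  interpret prob_space M by fact
  have Z: "Z \<in> borel_measurable M"
    using distributed_measurable[OF p(1)] by simp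
  \<comment> \<open>Since \<open>A\<close> has positive probability, the extended quotient defining
    \<open>uniform_measure\<close> is a real quotient, the form needed to integrate real functions
    against it.\<close>
  have u: "uniform_measure M A = density M (\<lambda>\<omega>. ennreal (indicator A \<omega> / measure M A))"
    unfolding uniform_measure_def using assms(3)
    by (intro arg_cong2[where f = density] refl ext)
       (simp add: emeasure_eq_measure divide_ennreal ennreal_indicator[symmetric])
  have "(LINT z|lborel. g z * p z) = (LINT z|lborel. p z * g z)"
    by (simp add: mult.commute)
  also have "\<dots> = (LINT \<omega>|uniform_measure M A. g (Z \<omega>))"
    using p g by (intro distributed_integral) auto
  also have "\<dots> = (LINT \<omega>|M. (indicator A \<omega> / measure M A) * g (Z \<omega>))"
    unfolding u using assms(2) measurable_compose[OF Z g]
    by (intro integral_real_density) auto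
  also have "\<dots> = (LINT \<omega>|M. g (Z \<omega>) * indicator A \<omega>) / measure M A"
    by (simp add: mult.commute)
  finally show ?thesis
    using assms(3) by simp
qed

section \<open>Independence of finitely valued random variables\<close>

text \<open>Independence is tested on singletons in one direction. Conversely, every event generated
  by \<open>A\<close> or \<open>B\<close> is a finite disjoint union of preimages of singletons, and
  additivity in both arguments extends the factorization to all such events.\<close>

lemma (in prob_space) indep_rv_count_space_iff:
  assumes "finite S" "finite T"
    and A: "A \<in> measurable M (count_space S)" and B: "B \<in> measurable M (count_space T)"
  shows "indep_rv M (count_space S) A (count_space T) B \<longleftrightarrow>
    (\<forall>s\<in>S. \<forall>t\<in>T. prob {\<omega> \<in> space M. A \<omega> = s \<and> B \<omega> = t} =
      prob {\<omega> \<in> space M. A \<omega> = s} * prob {\<omega> \<in> space M. B \<omega> = t})"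
    (is "_ \<longleftrightarrow> ?R")
proof -
  \<comment> \<open>Every subset is measurable in a counting space, so the generated sigma-algebras
    consist of the preimages of arbitrary subsets.\<close>
  have sets: "sets (vimage_algebra (space M) A (count_space S)) = {A -` U \<inter> space M |U. U \<subseteq> S}"
    "sets (vimage_algebra (space M) B (count_space T)) = {B -` U \<inter> space M |U. U \<subseteq> T}"
    using measurable_space[OF A] measurable_space[OF B] by (auto simp: sets_vimage_algebra2)
  have sub: "{A -` U \<inter> space M |U. U \<subseteq> S} \<subseteq> events" "{B -` U \<inter> space M |U. U \<subseteq> T} \<subseteq> events"
    using measurable_sets[OF A] measurable_sets[OF B] by auto
  have iff: "indep_rv M (count_space S) A (count_space T) B \<longleftrightarrow>
    (\<forall>U\<in>Pow S. \<forall>V\<in>Pow T. prob ((A -` U \<inter> space M) \<inter> (B -` V \<inter> space M)) =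
      prob (A -` U \<inter> space M) * prob (B -` V \<inter> space M))"
    unfolding indep_rv_def indep_sets2_eq sets using A B sub by blast
  show ?thesis
  proof
    assume L: "indep_rv M (count_space S) A (count_space T) B"
    show ?R
    proof (intro ballI)
      fix s t assume "s \<in> S" "t \<in> T"
      with L iff have "prob ((A -` {s} \<inter> space M) \<inter> (B -` {t} \<inter> space M)) =
          prob (A -` {s} \<inter> space M) * prob (B -` {t} \<inter> space M)"
        by auto
      moreover have "(A -` {s} \<inter> space M) \<inter> (B -` {t} \<inter> space M) = {\<omega> \<in> space M. A \<omega> = s \<and> B \<omega> = t}"
        "A -` {s} \<inter> space M = {\<omega> \<in> space M. A \<omega> = s}" "B -` {t} \<inter> space M = {\<omega> \<in> space M. B \<omega> = t}"
        by auto
      ultimately show "prob {\<omega> \<in> space M. A \<omega> = s \<and> B \<omega> = t} =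
          prob {\<omega> \<in> space M. A \<omega> = s} * prob {\<omega> \<in> space M. B \<omega> = t}"
        by simp
    qed
  next
    assume R: ?R
    have "prob ((A -` U \<inter> space M) \<inter> (B -` V \<inter> space M)) =
      prob (A -` U \<inter> space M) * prob (B -` V \<inter> space M)" if U: "U \<subseteq> S" and V: "V \<subseteq> T" for U V
    proof -
      have fin: "finite U" "finite V"
        using U V assms finite_subset by auto
      have ev: "{\<omega> \<in> space M. A \<omega> = s} \<in> events" "{\<omega> \<in> space M. B \<omega> = t} \<in> events" for s t
        using measurable_count_space_pred[OF A, of "\<lambda>a. a = s"]
          measurable_count_space_pred[OF B, of "\<lambda>b. b = t"] by auto
      have ev2: "{\<omega> \<in> space M. A \<omega> = s \<and> B \<omega> = t} \<in> events" for s t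
        using sets.Int[OF ev(1)[of s] ev(2)[of t]]
        by (rule back_subst[where P = "\<lambda>A. A \<in> events"]) auto
      have pA: "prob (A -` U \<inter> space M) = (\<Sum>s\<in>U. prob {\<omega> \<in> space M. A \<omega> = s})"
      proof -
        have "A -` U \<inter> space M = (\<Union>s\<in>U. {\<omega> \<in> space M. A \<omega> = s})"
          by auto
        then show ?thesis
          using fin ev by (auto intro!: finite_measure_finite_Union simp: disjoint_family_on_def)
      qed
      have pB: "prob (B -` V \<inter> space M) = (\<Sum>t\<in>V. prob {\<omega> \<in> space M. B \<omega> = t})"
      proof -
        have "B -` V \<inter> space M = (\<Union>t\<in>V. {\<omega> \<in> space M. B \<omega> = t})"
          by auto
        then show ?thesis
          using fin ev by (auto intro!: finite_measure_finite_Union simp: disjoint_family_on_def)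
      qed
      have "(A -` U \<inter> space M) \<inter> (B -` V \<inter> space M) =
          (\<Union>(s, t)\<in>U \<times> V. {\<omega> \<in> space M. A \<omega> = s \<and> B \<omega> = t})"
        by auto
      also have "prob \<dots> = (\<Sum>(s, t)\<in>U \<times> V. prob {\<omega> \<in> space M. A \<omega> = s \<and> B \<omega> = t})"
        unfolding case_prod_unfold using fin ev2
        by (intro finite_measure_finite_Union) (auto simp: disjoint_family_on_def)
      also have "\<dots> = (\<Sum>(s, t)\<in>U \<times> V. prob {\<omega> \<in> space M. A \<omega> = s} * prob {\<omega> \<in> space M. B \<omega> = t})"
        using R U V by (intro sum.cong) auto
      also have "\<dots> = prob (A -` U \<inter> space M) * prob (B -` V \<inter> space M)"
        unfolding pA pB by (simp add: sum_product sum.cartesian_product)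
      finally show ?thesis .
    qed
    then show "indep_rv M (count_space S) A (count_space T) B"
      using iff by auto
  qed
qed

section \<open>The expected loss\<close>

text \<open>The loss is the indicator of the complement of the event that \<open>W\<close> and
  \<open>Y\<close> agree, and this event splits according to the common value
  \<open>y i\<close>.\<close>

lemma expected_loss_eq:
  fixes y :: "nat \<Rightarrow> 'b"
  assumes "prob_space M"
    and Y: "Y \<in> measurable M (count_space (y ` {1..m}))"
    and W: "W \<in> measurable M (count_space (y ` {1..m}))"
    and inj: "inj_on y {1..m}"
  shows "expected_loss M Y W = 1 - (\<Sum>i\<in>{1..m}. measure M {\<omega> \<in> space M. W \<omega> = y i \<and> Y \<omega> = y i})"
proof -
  interpret prob_space M by fact
  let ?V = "\<lambda>i. {\<omega> \<in> space M. W \<omega> = y i \<and> Y \<omega> = y i}"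
  have V: "?V i \<in> events" for i
    using sets.Int[OF measurable_count_space_pred[OF W, of "\<lambda>w. w = y i"]
        measurable_count_space_pred[OF Y, of "\<lambda>w. w = y i"]]
    by (rule back_subst[where P = "\<lambda>A. A \<in> events"]) auto
  have "zero_one_loss (Y \<omega>) (W \<omega>) = indicator (space M - (\<Union>i\<in>{1..m}. ?V i)) \<omega>"
    if \<omega>: "\<omega> \<in> space M" for \<omega>
  proof -
    obtain i where "i \<in> {1..m}" "W \<omega> = y i"
      using measurable_space[OF W \<omega>] by auto
    then have "\<omega> \<in> (\<Union>i\<in>{1..m}. ?V i) \<longleftrightarrow> Y \<omega> = W \<omega>"
      using \<omega> by force
    then show ?thesis
      using \<omega> by (simp add: zero_one_loss_def indicator_def)
  qed
  then have "expected_loss M Y W = (LINT \<omega>|M. indicator (space M - (\<Union>i\<in>{1..m}. ?V i)) \<omega>)"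
    unfolding expected_loss_def by (intro Bochner_Integration.integral_cong) auto
  also have "\<dots> = prob (space M - (\<Union>i\<in>{1..m}. ?V i))"
    by (simp add: Int_absorb2)
  also have "\<dots> = 1 - prob (\<Union>i\<in>{1..m}. ?V i)"
    using V by (intro prob_compl sets.finite_UN) auto
  \<comment> \<open>Injectivity of \<open>y\<close> makes the agreement events disjoint, so no
    common value is counted twice.\<close>
  also have "prob (\<Union>i\<in>{1..m}. ?V i) = (\<Sum>i\<in>{1..m}. prob (?V i))"
    using V by (intro finite_measure_finite_Union) (auto simp: disjoint_family_on_def inj_on_eq_iff[OF inj])
  finally show ?thesis .
qed

section \<open>Linear functionals and dimension of the decision space\<close>

lemma linear_functional_sum:
  assumes "\<And>i. i \<in> I \<Longrightarrow> linear_functional m (\<phi> i)"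
  shows "linear_functional m (\<lambda>P. \<Sum>i\<in>I. \<phi> i P)"
  using assms unfolding linear_functional_def by (simp add: sum.distrib sum_distrib_left)

lemma linear_functional_uminus:
  "linear_functional m \<phi> \<Longrightarrow> linear_functional m (\<lambda>P. - \<phi> P)"
  unfolding linear_functional_def by simp

lemma linear_functional_component:
  "linear_functional m (\<lambda>P. P i z)"
  unfolding linear_functional_def by simp

text \<open>Stated for a general \<open>N\<close> and \<open>Z\<close> to serve twice: for the loss,
  over \<open>M\<close> with the measurement, and for the privacy constraints, over
  \<open>lborel\<close> with the identity. Boundedness in \<open>decision_space\<close> supplies the
  integrability that additivity of the integral requires.\<close>

lemma linear_functional_integral:
  fixes g :: "'c \<Rightarrow> real"
  assumes "integrable N g" "Z \<in> borel_measurable N" "i \<in> {1..m}"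
  shows "linear_functional m (\<lambda>P. LINT w|N. P i (Z w) * g w)"
  unfolding linear_functional_def
proof (intro ballI allI)
  fix P Q :: "nat \<Rightarrow> real \<Rightarrow> real" and a b :: real
  assume "P \<in> decision_space m" "Q \<in> decision_space m"
  then have PQ: "P i \<in> borel_measurable borel" "bounded (range (P i))"
      "Q i \<in> borel_measurable borel" "bounded (range (Q i))"
    using assms(3) by (auto simp: decision_space_def)
  have int: "integrable N (\<lambda>w. P i (Z w) * g w)" "integrable N (\<lambda>w. Q i (Z w) * g w)"
    using PQ assms(1,2)
    by (auto intro!: integrable_bounded_mult intro: bounded_subset measurable_compose)
  have "(LINT w|N. (a * P i (Z w) + b * Q i (Z w)) * g w) =
      (LINT w|N. a * (P i (Z w) * g w) + b * (Q i (Z w) * g w))"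
    by (simp add: algebra_simps)
  also have "\<dots> = a * (LINT w|N. P i (Z w) * g w) + b * (LINT w|N. Q i (Z w) * g w)"
    using int by simp
  finally show "(LINT w|N. (a * P i (Z w) + b * Q i (Z w)) * g w) =
      a * (LINT w|N. P i (Z w) * g w) + b * (LINT w|N. Q i (Z w) * g w)" .
qed

text \<open>The witnesses are the indicators of the points 0, ..., k - 1, repeated in every
  component. Independence is pointwise, so indicators of null sets do count, and evaluation at
  \<open>real r\<close> isolates the coefficient \<open>c r\<close>.\<close>

lemma infinite_dimensional_decision_space:
  assumes "1 \<le> m"
  shows "infinite_dimensional m (decision_space m)"
  unfolding infinite_dimensional_def
proof (intro allI exI[where x = "\<lambda>r i. indicator {real r}"] conjI impI)
  fix k r :: nat
  have "bounded (range (indicator {real r} :: real \<Rightarrow> real))"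
    by (rule boundedI[where B = 1]) (auto simp: indicator_def)
  then show "(\<lambda>i. indicator {real r}) \<in> decision_space m"
    by (simp add: decision_space_def)
next
  fix k r :: nat and c :: "nat \<Rightarrow> real"
  assume c: "\<forall>i\<in>{1..m}. \<forall>z. (\<Sum>r<k. c r * indicator {real r} z) = 0" and "r < k"
  have "(\<Sum>s<k. c s * indicator {real s} (real r)) = (\<Sum>s<k. if s = r then c s else 0)"
    by (intro sum.cong) (auto simp: indicator_def)
  also have "\<dots> = c r"
    using \<open>r < k\<close> by simp
  finally have "(\<Sum>s<k. c s * indicator {real s} (real r)) = c r" .
  \<comment> \<open>Component 1 exists because \<open>1 \<le> m\<close>.\<close>
  moreover have "(\<Sum>s<k. c s * indicator {real s} (real r)) = 0"
    using assms by (intro c[rule_format, of 1]) simp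
  ultimately show "c r = 0"
    by (rule trans[OF sym])
qed

section \<open>The privacy criterion and the linear optimization problem\<close>

text \<open>The conditional density \<open>pZX j\<close> is the density of \<open>Z\<close> under
  \<open>M\<close> conditioned on \<open>X = x j\<close>. \<open>Yhat\<close> selects a version of
  the estimator for every rule, so that the loss becomes a function of the rule. Infinite dimension
  refers to the ambient space of bounded measurable tuples.\<close>

theorem mainTheorem6:
  fixes M :: "'w measure"
    and X :: "'w \<Rightarrow> 'a" and Y :: "'w \<Rightarrow> 'b" and Z :: "'w \<Rightarrow> real"
    and n m :: nat and x :: "nat \<Rightarrow> 'a" and y :: "nat \<Rightarrow> 'b"
    and pZ :: "real \<Rightarrow> real" and pZX :: "nat \<Rightarrow> real \<Rightarrow> real"
  assumes "prob_space M"
    and "inj_on x {1..n}" and "inj_on y {1..m}"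
    and "X \<in> measurable M (count_space (x ` {1..n}))"
    and "Y \<in> measurable M (count_space (y ` {1..m}))"
    and "\<And>j. j \<in> {1..n} \<Longrightarrow> measure M {\<omega> \<in> space M. X \<omega> = x j} > 0"
    and "\<And>i. i \<in> {1..m} \<Longrightarrow> measure M {\<omega> \<in> space M. Y \<omega> = y i} > 0"
    and "\<And>z. 0 \<le> pZ z" and "distributed M lborel Z (\<lambda>z. ennreal (pZ z))"
    and "\<And>j z. j \<in> {1..n} \<Longrightarrow> 0 \<le> pZX j z"
    and "\<And>j. j \<in> {1..n} \<Longrightarrow>
           distributed (uniform_measure M {\<omega> \<in> space M. X \<omega> = x j}) lborel Z (\<lambda>z. ennreal (pZX j z))"
  shows
    "(\<forall>P W. randomization_rule m P \<and> randomized_estimator M X Y Z m y P W \<longrightarrow>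
        (indep_rv M (count_space (y ` {1..m})) W (count_space (x ` {1..n})) X \<longleftrightarrow>
         (\<forall>i\<in>{1..m}. \<forall>j\<in>{1..n}. (LINT z|lborel. P i z * (pZ z - pZX j z)) = 0))) \<and>
     (\<forall>Yhat. (\<forall>P. randomization_rule m P \<longrightarrow> randomized_estimator M X Y Z m y P (Yhat P)) \<longrightarrow>
        (\<forall>P. is_arg_min (\<lambda>Q. expected_loss M Y (Yhat Q))
                (\<lambda>Q. randomization_rule m Q \<and>
                     indep_rv M (count_space (y ` {1..m})) (Yhat Q) (count_space (x ` {1..n})) X) P
           \<longleftrightarrow>
             is_arg_min (\<lambda>Q. expected_loss M Y (Yhat Q))
                (\<lambda>Q. (\<forall>i\<in>{1..m}. Q i \<in> borel_measurable borel) \<and>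
                     (\<forall>i\<in>{1..m}. \<forall>z. 0 \<le> Q i z) \<and>
                     (\<forall>z. (\<Sum>i\<in>{1..m}. Q i z) = 1) \<and>
                     (\<forall>i\<in>{1..m}. \<forall>j\<in>{1..n}. (LINT z|lborel. Q i z * (pZ z - pZX j z)) = 0)) P) \<and>
        (\<exists>c \<phi>. linear_functional m \<phi> \<and>
           (\<forall>P. randomization_rule m P \<longrightarrow> expected_loss M Y (Yhat P) = c + \<phi> P))) \<and>
     (\<forall>i\<in>{1..m}. \<forall>z. linear_functional m (\<lambda>P. P i z)) \<and>
     (\<forall>z. linear_functional m (\<lambda>P. \<Sum>i\<in>{1..m}. P i z)) \<and>
     (\<forall>i\<in>{1..m}. \<forall>j\<in>{1..n}. linear_functional m (\<lambda>P. LINT z|lborel. P i z * (pZ z - pZX j z))) \<and>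
     infinite_dimensional m (decision_space m)"
proof -
  interpret prob_space M by fact
  note inj_y = assms(3) and X = assms(4) and Y = assms(5)
    and pos_X = assms(6) and pZ = assms(9,8) and pZX = assms(11,10)
  have Z: "Z \<in> borel_measurable M"
    using distributed_measurable[OF pZ(1)] by simp
  have XY: "{\<omega> \<in> space M. (X \<omega>, Y \<omega>) \<in> T} \<in> events" for T
    using measurable_Pair_pred_sets[OF _ X Y] by simp
  have X_event: "{\<omega> \<in> space M. X \<omega> = x j} \<in> events" for j
    using measurable_count_space_pred[OF X] .
  have Y_event: "{\<omega> \<in> space M. Y \<omega> = y i} \<in> events" for i
    using measurable_count_space_pred[OF Y] .
  \<comment> \<open>A probability space has a point, and \<open>Y\<close> takes one of the values
    \<open>y i\<close> there.\<close>
  have "1 \<le> m"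
    using measurable_space[OF Y] not_empty by fastforce
  have int_pZ: "integrable lborel pZ"
    using distributed_integrable_density[OF \<open>prob_space M\<close> pZ] .
  have int_pZX: "integrable lborel (pZX j)" if "j \<in> {1..n}" for j
  proof (rule distributed_integrable_density[OF _ pZX(1)[OF that] pZX(2)[OF that]])
    show "prob_space (uniform_measure M {\<omega> \<in> space M. X \<omega> = x j})"
      using pos_X[OF that] by (intro prob_space_uniform_measure) (auto simp: emeasure_eq_measure)
  qed
  have indep: "indep_rv M (count_space (y ` {1..m})) W (count_space (x ` {1..n})) X \<longleftrightarrow>
      (\<forall>i\<in>{1..m}. \<forall>j\<in>{1..n}. (LINT z|lborel. P i z * (pZ z - pZX j z)) = 0)"
    if rule: "randomization_rule m P" and est: "randomized_estimator M X Y Z m y P W" for P W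
  proof -
    have W: "W \<in> measurable M (count_space (y ` {1..m}))"
      using est by (simp add: randomized_estimator_def)
    have "prob {\<omega> \<in> space M. W \<omega> = y i \<and> X \<omega> = x j} =
          prob {\<omega> \<in> space M. W \<omega> = y i} * prob {\<omega> \<in> space M. X \<omega> = x j} \<longleftrightarrow>
        (LINT z|lborel. P i z * (pZ z - pZX j z)) = 0"
      if i: "i \<in> {1..m}" and j: "j \<in> {1..n}" for i j
    proof -
      have P: "P i \<in> borel_measurable borel" "bounded (range (P i))"
        using randomization_rule_decision_space[OF rule] i by (auto simp: decision_space_def)
      have "prob {\<omega> \<in> space M. W \<omega> = y i} = (LINT \<omega>|M. P i (Z \<omega>) * indicator (space M) \<omega>)"
        using prob_estimator_joint[OF \<open>prob_space M\<close> Z rule est i XY, of UNIV] by simp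
      also have "\<dots> = (LINT \<omega>|M. P i (Z \<omega>))"
        by (intro Bochner_Integration.integral_cong) auto
      also have "\<dots> = (LINT z|lborel. P i z * pZ z)"
        using distributed_integral[OF pZ(1), of "P i"] pZ(2) P by (simp add: mult.commute)
      finally have 1: "prob {\<omega> \<in> space M. W \<omega> = y i} = (LINT z|lborel. P i z * pZ z)" .
      have "prob {\<omega> \<in> space M. W \<omega> = y i \<and> X \<omega> = x j} =
          (LINT \<omega>|M. P i (Z \<omega>) * indicator {\<omega> \<in> space M. X \<omega> = x j} \<omega>)"
        using prob_estimator_joint[OF \<open>prob_space M\<close> Z rule est i XY, of "{x j} \<times> UNIV"] by simp
      also have "\<dots> = prob {\<omega> \<in> space M. X \<omega> = x j} * (LINT z|lborel. P i z * pZX j z)"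
        using integral_uniform_measure_distributed[OF \<open>prob_space M\<close> X_event pos_X[OF j] pZX(1)[OF j] pZX(2)[OF j] P(1)] .
      finally have 2: "prob {\<omega> \<in> space M. W \<omega> = y i \<and> X \<omega> = x j} =
          prob {\<omega> \<in> space M. X \<omega> = x j} * (LINT z|lborel. P i z * pZX j z)" .
      have "(LINT z|lborel. P i z * (pZ z - pZX j z)) =
          (LINT z|lborel. P i z * pZ z) - (LINT z|lborel. P i z * pZX j z)"
        using integrable_bounded_mult[OF int_pZ] integrable_bounded_mult[OF int_pZX[OF j]] P
        by (simp add: right_diff_distrib)
      \<comment> \<open>Factorization reads \<open>q * b = a * q\<close>, where \<open>q > 0\<close>
        is the probability of \<open>X = x j\<close> and \<open>a\<close>, \<open>b\<close> are the
        integrals of \<open>P i\<close> against \<open>pZ\<close> and \<open>pZX j\<close>.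
        Cancelling \<open>q\<close> leaves \<open>a = b\<close>.\<close>
      then show ?thesis
        unfolding 1 2 using pos_X[OF j] by auto
    qed
    then show ?thesis
      by (subst indep_rv_count_space_iff[OF _ _ W X]) auto
  qed
  have loss: "\<exists>c \<phi>. linear_functional m \<phi> \<and>
      (\<forall>P. randomization_rule m P \<longrightarrow> expected_loss M Y (Yhat P) = c + \<phi> P)"
    if est: "\<forall>P. randomization_rule m P \<longrightarrow> randomized_estimator M X Y Z m y P (Yhat P)" for Yhat
  proof (intro exI conjI allI impI)
    \<comment> \<open>This is the probability of a correct estimate, written over \<open>M\<close>
      with indicators of \<open>Y = y i\<close> and without reference to \<open>Yhat\<close>. The
      loss is then affine with \<open>c = 1\<close> and linear part
      \<open>- ?\<psi>\<close>.\<close>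
    let ?\<psi> = "\<lambda>P :: nat \<Rightarrow> real \<Rightarrow> real.
      \<Sum>i\<in>{1..m}. LINT \<omega>|M. P i (Z \<omega>) * indicator {\<omega> \<in> space M. Y \<omega> = y i} \<omega>"
    have "integrable M (indicator {\<omega> \<in> space M. Y \<omega> = y i} :: 'w \<Rightarrow> real)" for i
      using Y_event[of i] by (simp add: integrable_indicator_iff less_top[symmetric])
    then show "linear_functional m (\<lambda>P. - ?\<psi> P)"
      using Z by (intro linear_functional_uminus linear_functional_sum linear_functional_integral)
    fix P assume rule: "randomization_rule m P"
    with est have est_P: "randomized_estimator M X Y Z m y P (Yhat P)"
      by simp
    then have W: "Yhat P \<in> measurable M (count_space (y ` {1..m}))"
      by (simp add: randomized_estimator_def)
    have "prob {\<omega> \<in> space M. Yhat P \<omega> = y i \<and> Y \<omega> = y i} =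
        (LINT \<omega>|M. P i (Z \<omega>) * indicator {\<omega> \<in> space M. Y \<omega> = y i} \<omega>)" if "i \<in> {1..m}" for i
      using prob_estimator_joint[OF \<open>prob_space M\<close> Z rule est_P that XY, of "UNIV \<times> {y i}"] by simp
    then show "expected_loss M Y (Yhat P) = 1 + - ?\<psi> P"
      using expected_loss_eq[OF \<open>prob_space M\<close> Y W inj_y] by simp
  qed
  have argmin: "is_arg_min (\<lambda>Q. expected_loss M Y (Yhat Q))
      (\<lambda>Q. randomization_rule m Q \<and>
         indep_rv M (count_space (y ` {1..m})) (Yhat Q) (count_space (x ` {1..n})) X) P \<longleftrightarrow>
    is_arg_min (\<lambda>Q. expected_loss M Y (Yhat Q))
      (\<lambda>Q. (\<forall>i\<in>{1..m}. Q i \<in> borel_measurable borel) \<and>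
           (\<forall>i\<in>{1..m}. \<forall>z. 0 \<le> Q i z) \<and>
           (\<forall>z. (\<Sum>i\<in>{1..m}. Q i z) = 1) \<and>
           (\<forall>i\<in>{1..m}. \<forall>j\<in>{1..n}. (LINT z|lborel. Q i z * (pZ z - pZX j z)) = 0)) P"
    if est: "\<forall>P. randomization_rule m P \<longrightarrow> randomized_estimator M X Y Z m y P (Yhat P)" for Yhat P
  \<comment> \<open>The objective is the same on both sides, so equality of the feasibility
    predicates suffices. Each of them contains the rule conditions under which \<open>indep\<close>
    applies.\<close>
  proof (rule arg_cong[where f = "\<lambda>F. is_arg_min _ F P"], rule ext)
    fix Q
    show "(randomization_rule m Q \<and>
         indep_rv M (count_space (y ` {1..m})) (Yhat Q) (count_space (x ` {1..n})) X) =
      ((\<forall>i\<in>{1..m}. Q i \<in> borel_measurable borel) \<and>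
           (\<forall>i\<in>{1..m}. \<forall>z. 0 \<le> Q i z) \<and>
           (\<forall>z. (\<Sum>i\<in>{1..m}. Q i z) = 1) \<and>
           (\<forall>i\<in>{1..m}. \<forall>j\<in>{1..n}. (LINT z|lborel. Q i z * (pZ z - pZX j z)) = 0))"
      using indep[of Q "Yhat Q"] est unfolding randomization_rule_def by blast
  qed
  \<comment> \<open>The weight \<open>pZ z - pZX j z\<close> is integrable as a difference of two
    integrable densities.\<close>
  have constraint: "linear_functional m (\<lambda>P. LINT z|lborel. P i z * (pZ z - pZX j z))"
    if "i \<in> {1..m}" "j \<in> {1..n}" for i j
    using linear_functional_integral[of lborel "\<lambda>z. pZ z - pZX j z" "\<lambda>z. z"] int_pZ int_pZX that
    by simp
  show ?thesis
    using indep loss argmin constraint infinite_dimensional_decision_space[OF \<open>1 \<le> m\<close>]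
      linear_functional_component linear_functional_sum[of _ m "\<lambda>i P. P i _"]
    by (intro conjI allI ballI impI) auto
qed

end
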